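(* Let $(X,X_{\mathbb{R}},\|\cdot\|_X)$ and $(Y,Y_{\mathbb{R}},\|\cdot\|_Y)$ be complexified function spaces, let $\|\cdot\|_X$ be absolute and let $\|\cdot\|_Y$ be absolute and monotonic, and let $A:X\to Y$ be a nonnegative linear operator. Then $\|A\|_{X,Y}^{\mathbb{C}}=\|A\|_{X,Y}^{\mathbb{R}}$.
   Context: A normed complexified space is a triple $(X,X_{\mathbb{R}},\|\cdot\|_X)$ where $X$ is a complex vector space, $X_{\mathbb{R}}$ is a real vector space, $X$ is the algebraic complexification of $X_{\mathbb{R}}$ (each $x\in X$ is uniquely $x=x_1+ix_2$ with $x_1,x_2\in X_{\mathbb{R}}$; put $\operatorname{Re}x=x_1$, $\operatorname{Im}x=x_2$), and $\|\cdot\|_X$ is a norm on the complex vector space $X$. It is a complexified function space if $X_{\mathbb{R}}$ is a vector space of real-valued functions on some set (so $X$ consists of complex-valued functions). The norm $\|\cdot\|_X$ is absolute if for each $x\in X$ the absolute value function $|x|=\sqrt{(\operatorname{Re}x)^2+(\operatorname{Im}x)^2}$ belongs to $X_{\mathbb{R}}$ and $\|x\|_X=\|\,|x|\,\|_X$. The norm $\|\cdot\|_Y$ is monotonic if for $f,g\in Y_{\mathbb{R}}$ with $0\le f\le g$ pointwise one has $\|f\|_Y\le\|g\|_Y$. A $\mathbb{C}$-linear operator $A:X\to Y$ is nonnegative if $A(X_{\mathbb{R}})\subseteq Y_{\mathbb{R}}$ and $A$ maps (pointwise) nonnegative functions in $X_{\mathbb{R}}$ to nonnegative functions in $Y_{\mathbb{R}}$.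 The operator norms, with values in $[0,\infty]$, are $$\|A\|_{X,Y}^{\mathbb{C}}=\sup_{x\in X\setminus\{0\}}\frac{\|Ax\|_Y}{\|x\|_X},\qquad \|A\|_{X,Y}^{\mathbb{R}}=\sup_{x\in X_{\mathbb{R}}\setminus\{0\}}\frac{\|Ax\|_Y}{\|x\|_X}.$$ *)

theory Defs
  imports Complex_Main "HOL-Library.Function_Algebras" "HOL-Library.Extended_Nonnegative_Real"
begin

text \<open>
  The set on which the functions live is the type \<open>'s\<close>; zero, addition and order on functions are
  the pointwise ones. The real space \<open>XR\<close> consists of functions \<open>'s \<Rightarrow> real\<close> and is regarded
  as a part of the complex space \<open>X\<close> via \<open>of_real_fun\<close>.
\<close>

definition scale_fun :: "'k::field \<Rightarrow> ('s \<Rightarrow> 'k) \<Rightarrow> 's \<Rightarrow> 'k" where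
  "scale_fun c f = (\<lambda>s. c * f s)"

global_interpretation fun_space: vector_space "scale_fun :: 'k::field \<Rightarrow> ('s \<Rightarrow> 'k) \<Rightarrow> 's \<Rightarrow> 'k"
  by unfold_locales (auto simp: scale_fun_def algebra_simps fun_eq_iff)

definition of_real_fun :: "('s \<Rightarrow> real) \<Rightarrow> 's \<Rightarrow> complex" where
  "of_real_fun f = (\<lambda>s. complex_of_real (f s))"

definition norm_on :: "('s \<Rightarrow> complex) set \<Rightarrow> (('s \<Rightarrow> complex) \<Rightarrow> real) \<Rightarrow> bool" where
  "norm_on X N \<longleftrightarrow>
     (\<forall>x\<in>X. 0 \<le> N x \<and> (N x = 0 \<longleftrightarrow> x = 0)) \<and>
     (\<forall>c. \<forall>x\<in>X. N (scale_fun c x) = cmod c * N x) \<and>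
     (\<forall>x\<in>X. \<forall>y\<in>X. N (x + y) \<le> N x + N y)"

locale complexified_function_space =
  fixes X :: "('s \<Rightarrow> complex) set" and XR :: "('s \<Rightarrow> real) set"
    and N :: "('s \<Rightarrow> complex) \<Rightarrow> real"
  assumes complex_subspace: "fun_space.subspace X"
    and real_subspace: "fun_space.subspace XR"
    and real_subset: "of_real_fun ` XR \<subseteq> X"
    and unique_decomposition:
      "x \<in> X \<Longrightarrow> \<exists>!(f, g). f \<in> XR \<and> g \<in> XR \<and> x = of_real_fun f + scale_fun \<i> (of_real_fun g)"
    and norm: "norm_on X N"
begin

lemma mem_iff: "x \<in> X \<longleftrightarrow> (\<lambda>s. Re (x s)) \<in> XR \<and> (\<lambda>s. Im (x s)) \<in> XR"
proof
  assume "x \<in> X"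
  then obtain f g where fg: "f \<in> XR" "g \<in> XR" "x = of_real_fun f + scale_fun \<i> (of_real_fun g)"
    using unique_decomposition by blast
  then have "(\<lambda>s. Re (x s)) = f" "(\<lambda>s. Im (x s)) = g"
    by (auto simp: of_real_fun_def scale_fun_def)
  with fg show "(\<lambda>s. Re (x s)) \<in> XR \<and> (\<lambda>s. Im (x s)) \<in> XR" by simp
next
  assume "(\<lambda>s. Re (x s)) \<in> XR \<and> (\<lambda>s. Im (x s)) \<in> XR"
  then have "of_real_fun (\<lambda>s. Re (x s)) + scale_fun \<i> (of_real_fun (\<lambda>s. Im (x s))) \<in> X"
    using real_subset complex_subspace
    by (intro fun_space.subspace_add fun_space.subspace_scale) auto
  also have "of_real_fun (\<lambda>s. Re (x s)) + scale_fun \<i> (of_real_fun (\<lambda>s. Im (x s))) = x"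
    by (auto simp: of_real_fun_def scale_fun_def complex_eq_iff fun_eq_iff)
  finally show "x \<in> X" .
qed

end

text \<open>Note that \<open>cmod z = sqrt ((Re z)\<^sup>2 + (Im z)\<^sup>2)\<close> by definition.\<close>

definition absolute_norm ::
  "('s \<Rightarrow> complex) set \<Rightarrow> ('s \<Rightarrow> real) set \<Rightarrow> (('s \<Rightarrow> complex) \<Rightarrow> real) \<Rightarrow> bool" where
  "absolute_norm X XR N \<longleftrightarrow>
     (\<forall>x\<in>X. (\<lambda>s. cmod (x s)) \<in> XR \<and> N x = N (of_real_fun (\<lambda>s. cmod (x s))))"

definition monotonic_norm :: "('s \<Rightarrow> real) set \<Rightarrow> (('s \<Rightarrow> complex) \<Rightarrow> real) \<Rightarrow> bool" where
  "monotonic_norm XR N \<longleftrightarrow>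
     (\<forall>f\<in>XR. \<forall>g\<in>XR. 0 \<le> f \<and> f \<le> g \<longrightarrow> N (of_real_fun f) \<le> N (of_real_fun g))"

definition linear_operator ::
  "('s \<Rightarrow> complex) set \<Rightarrow> ('t \<Rightarrow> complex) set \<Rightarrow> (('s \<Rightarrow> complex) \<Rightarrow> 't \<Rightarrow> complex) \<Rightarrow> bool" where
  "linear_operator X Y A \<longleftrightarrow>
     A ` X \<subseteq> Y \<and>
     (\<forall>x\<in>X. \<forall>y\<in>X. A (x + y) = A x + A y) \<and>
     (\<forall>c. \<forall>x\<in>X. A (scale_fun c x) = scale_fun c (A x))"

definition nonnegative_operator ::
  "('s \<Rightarrow> real) set \<Rightarrow> ('t \<Rightarrow> real) set \<Rightarrow> (('s \<Rightarrow> complex) \<Rightarrow> 't \<Rightarrow> complex) \<Rightarrow> bool" where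
  "nonnegative_operator XR YR A \<longleftrightarrow>
     A ` of_real_fun ` XR \<subseteq> of_real_fun ` YR \<and>
     A ` of_real_fun ` {f \<in> XR. 0 \<le> f} \<subseteq> of_real_fun ` {g \<in> YR. 0 \<le> g}"

text \<open>In \<open>ennreal\<close> the supremum over the empty set is \<open>0\<close>, so the norms vanish if \<open>X = {0}\<close>.\<close>

definition opnorm_complex ::
  "('s \<Rightarrow> complex) set \<Rightarrow> (('s \<Rightarrow> complex) \<Rightarrow> real) \<Rightarrow> (('t \<Rightarrow> complex) \<Rightarrow> real) \<Rightarrow>
   (('s \<Rightarrow> complex) \<Rightarrow> 't \<Rightarrow> complex) \<Rightarrow> ennreal" where
  "opnorm_complex X NX NY A = (SUP x\<in>X - {0}. ennreal (NY (A x) / NX x))"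

definition opnorm_real ::
  "('s \<Rightarrow> real) set \<Rightarrow> (('s \<Rightarrow> complex) \<Rightarrow> real) \<Rightarrow> (('t \<Rightarrow> complex) \<Rightarrow> real) \<Rightarrow>
   (('s \<Rightarrow> complex) \<Rightarrow> 't \<Rightarrow> complex) \<Rightarrow> ennreal" where
  "opnorm_real XR NX NY A =
     (SUP f\<in>XR - {0}. ennreal (NY (A (of_real_fun f)) / NX (of_real_fun f)))"

end

theory Submission
  imports Defs
begin

text \<open>
  The heart of the matter is the pointwise domination \<open>\<bar>A x\<bar> \<le> A \<bar>x\<bar>\<close> for a nonnegative operator
  \<open>A\<close> (\<open>cmod_nonnegative_operator_le\<close>). It is obtained by rotation: at a fixed point \<open>t\<close> there is a
  unimodular constant \<open>c\<close> such that \<open>c * A x t\<close> equals \<open>\<bar>A x t\<bar>\<close>. Since \<open>A\<close> maps real functions to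
  real functions, \<open>c * A x t = A (c x) t\<close> being real, it is the value at \<open>t\<close> of \<open>A (Re (c x))\<close>; and
  \<open>Re (c x) \<le> \<bar>c x\<bar> = \<bar>x\<bar>\<close> together with monotonicity of \<open>A\<close> on real functions gives the bound.
  The constant \<open>c\<close> depends on \<open>t\<close>, which is harmless because only values at \<open>t\<close> are compared.

  Absoluteness and monotonicity of the norm on \<open>Y\<close> turn this domination into
  \<open>\<parallel>A x\<parallel> \<le> \<parallel>A \<bar>x\<bar>\<parallel>\<close>, while \<open>\<parallel>x\<parallel> = \<parallel>\<bar>x\<bar>\<parallel>\<close>. So the quotient of a complex function \<open>x\<close> is at most the
  quotient of the real function \<open>\<bar>x\<bar>\<close>, and the complex supremum does not exceed the real one. The
  converse inequality holds because real functions are among the complex ones.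
\<close>

lemma nonnegative_operator_mono:
  assumes X: "complexified_function_space X XR NX"
    and lin: "linear_operator X Y A"
    and nonneg: "nonnegative_operator XR YR A"
    and f: "f \<in> XR" and g: "g \<in> XR" and le: "f \<le> g"
  shows "Re (A (of_real_fun f) t) \<le> Re (A (of_real_fun g) t)"
proof -
  interpret complexified_function_space X XR NX by (rule X)
  have diff: "g - f \<in> XR"
    using real_subspace g f by (rule fun_space.subspace_diff)
  moreover have "0 \<le> g - f"
    using le by (simp add: le_fun_def)
  ultimately have "A (of_real_fun (g - f)) \<in> of_real_fun ` {h \<in> YR. 0 \<le> h}"
    using nonneg unfolding nonnegative_operator_def by blast
  then have pos: "0 \<le> Re (A (of_real_fun (g - f)) t)"
    by (auto simp: of_real_fun_def le_fun_def)
  have "of_real_fun g = of_real_fun f + of_real_fun (g - f)"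
    by (simp add: of_real_fun_def fun_eq_iff)
  moreover have "of_real_fun f \<in> X" "of_real_fun (g - f) \<in> X"
    using real_subset f diff by auto
  ultimately have "A (of_real_fun g) = A (of_real_fun f) + A (of_real_fun (g - f))"
    using lin unfolding linear_operator_def by metis
  with pos show ?thesis by simp
qed

lemma Re_nonnegative_operator:
  assumes X: "complexified_function_space X XR NX"
    and lin: "linear_operator X Y A"
    and nonneg: "nonnegative_operator XR YR A"
    and x: "x \<in> X"
  shows "Re (A x t) = Re (A (of_real_fun (\<lambda>s. Re (x s))) t)"
proof -
  interpret complexified_function_space X XR NX by (rule X)
  let ?u = "of_real_fun (\<lambda>s. Re (x s))" and ?v = "of_real_fun (\<lambda>s. Im (x s))"
  have "(\<lambda>s. Re (x s)) \<in> XR" and v: "(\<lambda>s. Im (x s)) \<in> XR"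
    using x mem_iff by auto
  then have uX: "?u \<in> X" and vX: "?v \<in> X"
    using real_subset by auto
  then have "scale_fun \<i> ?v \<in> X"
    using complex_subspace fun_space.subspace_scale by blast
  moreover have "x = ?u + scale_fun \<i> ?v"
    by (auto simp: of_real_fun_def scale_fun_def complex_eq_iff fun_eq_iff)
  ultimately have "A x = A ?u + scale_fun \<i> (A ?v)"
    using lin uX vX unfolding linear_operator_def by metis
  moreover have "A ?v \<in> of_real_fun ` YR"
    using nonneg v unfolding nonnegative_operator_def by blast
  then have "Im (A ?v t) = 0"
    by (auto simp: of_real_fun_def)
  ultimately show ?thesis
    by (simp add: scale_fun_def)
qed

text \<open>Multiplying \<open>x\<close> by a unimodular constant that makes \<open>A x t\<close> nonnegative changes neither side
  of the inequality, and reduces it to monotonicity of \<open>A\<close> on the real functions \<open>Re x \<le> \<bar>x\<bar>\<close>.\<close>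

lemma cmod_nonnegative_operator_le:
  assumes X: "complexified_function_space X XR NX"
    and abs: "absolute_norm X XR NX"
    and lin: "linear_operator X Y A"
    and nonneg: "nonnegative_operator XR YR A"
    and x: "x \<in> X"
  shows "cmod (A x t) \<le> Re (A (of_real_fun (\<lambda>s. cmod (x s))) t)"
proof -
  interpret complexified_function_space X XR NX by (rule X)
  define c where "c = cis (- Arg (A x t))"
  have c: "cmod c = 1"
    by (simp add: c_def)
  have "A x t = of_real (cmod (A x t)) * cis (Arg (A x t))"
    using rcis_cmod_Arg[of "A x t"] by (simp add: rcis_def)
  then have rot: "c * A x t = of_real (cmod (A x t))"
    unfolding c_def by (metis add.right_inverse cis_mult cis_zero mult.commute mult.left_commute mult.right_neutral)
  let ?y = "scale_fun c x"
  have y: "?y \<in> X"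
    using complex_subspace x by (rule fun_space.subspace_scale)
  have "A ?y = scale_fun c (A x)"
    using lin x unfolding linear_operator_def by blast
  then have "cmod (A x t) = Re (A ?y t)"
    using rot by (simp add: scale_fun_def)
  also have "\<dots> = Re (A (of_real_fun (\<lambda>s. Re (?y s))) t)"
    by (rule Re_nonnegative_operator[OF X lin nonneg y])
  also have "\<dots> \<le> Re (A (of_real_fun (\<lambda>s. cmod (x s))) t)"
  proof (rule nonnegative_operator_mono[OF X lin nonneg])
    show "(\<lambda>s. Re (?y s)) \<in> XR"
      using y mem_iff by blast
    show "(\<lambda>s. cmod (x s)) \<in> XR"
      using abs x by (simp add: absolute_norm_def)
    have "Re (c * x s) \<le> cmod (x s)" for s
      using complex_Re_le_cmod[of "c * x s"] c by (simp add: norm_mult)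
    then show "(\<lambda>s. Re (?y s)) \<le> (\<lambda>s. cmod (x s))"
      by (simp add: le_fun_def scale_fun_def)
  qed
  finally show ?thesis .
qed

lemma norm_nonnegative_operator_le_norm_abs:
  assumes X: "complexified_function_space X XR NX"
    and absX: "absolute_norm X XR NX"
    and absY: "absolute_norm Y YR NY"
    and mono: "monotonic_norm YR NY"
    and lin: "linear_operator X Y A"
    and nonneg: "nonnegative_operator XR YR A"
    and x: "x \<in> X"
  shows "NY (A x) \<le> NY (A (of_real_fun (\<lambda>s. cmod (x s))))"
proof -
  have "(\<lambda>s. cmod (x s)) \<in> XR"
    using absX x by (simp add: absolute_norm_def)
  then have "A (of_real_fun (\<lambda>s. cmod (x s))) \<in> of_real_fun ` YR"
    using nonneg unfolding nonnegative_operator_def by blast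
  then obtain g where g: "g \<in> YR" and Ag: "A (of_real_fun (\<lambda>s. cmod (x s))) = of_real_fun g"
    by blast
  have "A x \<in> Y"
    using lin x unfolding linear_operator_def by blast
  then have abs_Ax: "(\<lambda>t. cmod (A x t)) \<in> YR"
    and "NY (A x) = NY (of_real_fun (\<lambda>t. cmod (A x t)))"
    using absY by (auto simp: absolute_norm_def)
  note this(2)
  also have "\<dots> \<le> NY (of_real_fun g)"
  proof -
    have "cmod (A x t) \<le> g t" for t
      using cmod_nonnegative_operator_le[OF X absX lin nonneg x, of t] Ag
      by (simp add: of_real_fun_def)
    then have "(\<lambda>t. cmod (A x t)) \<le> g" and "0 \<le> (\<lambda>t. cmod (A x t))"
      by (simp_all add: le_fun_def)
    then show ?thesis
      using mono abs_Ax g unfolding monotonic_norm_def by blast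
  qed
  finally show ?thesis
    using Ag by simp
qed

theorem theorem3p10:
  fixes X :: "('s \<Rightarrow> complex) set" and XR :: "('s \<Rightarrow> real) set"
    and NX :: "('s \<Rightarrow> complex) \<Rightarrow> real"
    and Y :: "('t \<Rightarrow> complex) set" and YR :: "('t \<Rightarrow> real) set"
    and NY :: "('t \<Rightarrow> complex) \<Rightarrow> real"
    and A :: "('s \<Rightarrow> complex) \<Rightarrow> 't \<Rightarrow> complex"
  assumes "complexified_function_space X XR NX"
    and "complexified_function_space Y YR NY"
    and "absolute_norm X XR NX"
    and "absolute_norm Y YR NY"
    and "monotonic_norm YR NY"
    and "linear_operator X Y A"
    and "nonnegative_operator XR YR A"
  shows "opnorm_complex X NX NY A = opnorm_real XR NX NY A"
proof (rule antisym)
  interpret X: complexified_function_space X XR NX by (rule assms(1))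
  show "opnorm_complex X NX NY A \<le> opnorm_real XR NX NY A"
    unfolding opnorm_complex_def opnorm_real_def
  proof (rule SUP_mono)
    fix x assume "x \<in> X - {0}"
    then have x: "x \<in> X" and "x \<noteq> 0" by auto
    let ?a = "\<lambda>s. cmod (x s)"
    have "?a \<in> XR" and NX_abs: "NX x = NX (of_real_fun ?a)"
      using assms(3) x by (auto simp: absolute_norm_def)
    moreover have "?a \<noteq> 0"
      using \<open>x \<noteq> 0\<close> by (auto simp: fun_eq_iff)
    ultimately have "?a \<in> XR - {0}"
      by simp
    moreover have "0 \<le> NX x"
      using X.norm x by (simp add: norm_on_def)
    then have "NY (A x) / NX x \<le> NY (A (of_real_fun ?a)) / NX (of_real_fun ?a)"
      using norm_nonnegative_operator_le_norm_abs[OF assms(1,3-7) x] NX_abs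
      by (simp add: divide_right_mono)
    then have "ennreal (NY (A x) / NX x) \<le> ennreal (NY (A (of_real_fun ?a)) / NX (of_real_fun ?a))"
      by (rule ennreal_leI)
    ultimately show "\<exists>f\<in>XR - {0}. ennreal (NY (A x) / NX x)
        \<le> ennreal (NY (A (of_real_fun f)) / NX (of_real_fun f))"
      by blast
  qed
  show "opnorm_real XR NX NY A \<le> opnorm_complex X NX NY A"
    unfolding opnorm_complex_def opnorm_real_def
  proof (rule SUP_mono)
    fix f assume "f \<in> XR - {0}"
    then have "of_real_fun f \<in> X - {0}"
      using X.real_subset by (auto simp: of_real_fun_def fun_eq_iff)
    then show "\<exists>x\<in>X - {0}. ennreal (NY (A (of_real_fun f)) / NX (of_real_fun f))
        \<le> ennreal (NY (A x) / NX x)"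
      by blast
  qed
qed

end
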